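(* Let $0<\alpha\leq\infty$ and let $f$ be a real polynomial of degree not greater than $5$ which is $2$-convex in $[0,\alpha)$ and satisfies $f(0)\leq 0$. Then the function $g(t) = f(t)/t$ is $2$-monotone in $(0,\alpha)$.
   Context: $M_2$ is the algebra of complex $2\times 2$ matrices, $\leq$ is the Loewner order on selfadjoint matrices, and $f(a)$ is defined by functional calculus. A function $f\colon I\to\mathbf{R}$ on an interval $I$ is $2$-monotone if $f(a)\leq f(b)$ for every pair of selfadjoint $a,b\in M_2$ with $a\leq b$ and all eigenvalues of $a$ and $b$ in $I$; it is $2$-convex if $f(\lambda a+(1-\lambda)b)\leq \lambda f(a)+(1-\lambda)f(b)$ for all selfadjoint $a,b\in M_2$ with all eigenvalues in $I$ and all $\lambda\in[0,1]$. *)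

theory Defs
  imports "HOL-Analysis.Analysis" "HOL-Computational_Algebra.Polynomial"
begin

definition mat_adj :: "complex ^ 'n ^ 'n \<Rightarrow> complex ^ 'n ^ 'n" where
  "mat_adj a = (\<chi> i j. cnj (a $ j $ i))"

definition selfadjoint :: "complex ^ 'n ^ 'n \<Rightarrow> bool" where
  "selfadjoint a \<longleftrightarrow> mat_adj a = a"

definition unitary :: "complex ^ 'n::finite ^ 'n \<Rightarrow> bool" where
  "unitary u \<longleftrightarrow> mat_adj u ** u = mat 1 \<and> u ** mat_adj u = mat 1"

definition eigenvalues :: "complex ^ 'n::finite ^ 'n \<Rightarrow> complex set" where
  "eigenvalues a = {z. \<exists>v. v \<noteq> 0 \<and> a *v v = z *s v}"

(* For selfadjoint m the quadratic form is real-valued, so taking Re loses nothing. *)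
definition positive_semidef :: "complex ^ 'n::finite ^ 'n \<Rightarrow> bool" where
  "positive_semidef m \<longleftrightarrow>
     selfadjoint m \<and> (\<forall>x. 0 \<le> Re (\<Sum>i\<in>UNIV. cnj (x $ i) * (m *v x) $ i))"

definition loewner_le :: "complex ^ 'n::finite ^ 'n \<Rightarrow> complex ^ 'n ^ 'n \<Rightarrow> bool"
  (infix "\<le>\<^sub>L" 50) where
  "a \<le>\<^sub>L b \<longleftrightarrow> positive_semidef (b - a)"

definition real_diag :: "('n \<Rightarrow> real) \<Rightarrow> complex ^ 'n ^ 'n" where
  "real_diag d = (\<chi> i j. if i = j then complex_of_real (d i) else 0)"

(* Functional calculus: if a = u diag(d) u* with u unitary and d real, then
   f(a) = u diag(f(d)) u*.  By fun_calc_eq below the result does not depend on the choice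
   of u and d, so the description is proper for every unitarily diagonalizable a with real
   spectrum, i.e. for every selfadjoint a. *)
definition fun_calc :: "(real \<Rightarrow> real) \<Rightarrow> complex ^ 'n::finite ^ 'n \<Rightarrow> complex ^ 'n ^ 'n" where
  "fun_calc f a = (THE b. \<exists>u d. unitary u \<and> a = u ** real_diag d ** mat_adj u
                            \<and> b = u ** real_diag (f \<circ> d) ** mat_adj u)"

lemma matrix_mult_real_diag_right:
  fixes w :: "complex ^ 'n::finite ^ 'n"
  shows "(w ** real_diag d) $ i $ j = w $ i $ j * complex_of_real (d j)"
proof -
  have "(w ** real_diag d) $ i $ j
      = (\<Sum>k\<in>UNIV. if k = j then w $ i $ k * complex_of_real (d k) else 0)"
    unfolding matrix_matrix_mult_def real_diag_def vec_lambda_beta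
    by (rule sum.cong) auto
  then show ?thesis by simp
qed

lemma matrix_mult_real_diag_left:
  fixes w :: "complex ^ 'n::finite ^ 'n"
  shows "(real_diag d ** w) $ i $ j = complex_of_real (d i) * w $ i $ j"
proof -
  have "(real_diag d ** w) $ i $ j
      = (\<Sum>k\<in>UNIV. if i = k then complex_of_real (d i) * w $ k $ j else 0)"
    unfolding matrix_matrix_mult_def real_diag_def vec_lambda_beta
    by (rule sum.cong) auto
  then show ?thesis by simp
qed

lemma real_diag_intertwine:
  fixes w :: "complex ^ 'n::finite ^ 'n"
  assumes "w ** real_diag d = real_diag e ** w"
  shows "w ** real_diag (f \<circ> d) = real_diag (f \<circ> e) ** w"
proof -
  have "w $ i $ j * complex_of_real (f (d j)) = complex_of_real (f (e i)) * w $ i $ j" for i j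
  proof (cases "w $ i $ j = 0")
    case False
    have "w $ i $ j * complex_of_real (d j) = complex_of_real (e i) * w $ i $ j"
      using assms matrix_mult_real_diag_right[of w d i j] matrix_mult_real_diag_left[of e w i j]
      by metis
    with False have "d j = e i"
      by simp
    then show ?thesis by simp
  qed simp
  then show ?thesis
    by (simp add: vec_eq_iff matrix_mult_real_diag_right matrix_mult_real_diag_left)
qed

lemma unitary_diag_unique:
  fixes u v :: "complex ^ 'n::finite ^ 'n"
  assumes u: "unitary u" and v: "unitary v"
    and eq: "u ** real_diag d ** mat_adj u = v ** real_diag e ** mat_adj v"
  shows "u ** real_diag (f \<circ> d) ** mat_adj u = v ** real_diag (f \<circ> e) ** mat_adj v"
proof -
  let ?w = "mat_adj v ** u"
  have u': "mat_adj u ** u = mat 1" "u ** mat_adj u = mat 1"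
    and v': "mat_adj v ** v = mat 1" "v ** mat_adj v = mat 1"
    using u v by (auto simp: unitary_def)
  have cancel: "x ** mat_adj u ** u = x" "x ** u ** mat_adj u = x" for x :: "complex ^ 'n ^ 'n"
    by (simp_all add: u' flip: matrix_mul_assoc)
  have "?w ** real_diag d = mat_adj v ** (u ** real_diag d ** mat_adj u) ** u"
    by (simp add: matrix_mul_assoc cancel)
  also have "\<dots> = real_diag e ** ?w"
    unfolding eq by (simp add: matrix_mul_assoc v')
  finally have w: "?w ** real_diag (f \<circ> d) = real_diag (f \<circ> e) ** ?w"
    by (rule real_diag_intertwine)
  have "u ** real_diag (f \<circ> d) ** mat_adj u = v ** (?w ** real_diag (f \<circ> d)) ** mat_adj u"
    by (simp add: matrix_mul_assoc v')
  also have "\<dots> = v ** real_diag (f \<circ> e) ** mat_adj v"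
    unfolding w by (simp add: matrix_mul_assoc cancel)
  finally show ?thesis .
qed

lemma fun_calc_eq:
  fixes u :: "complex ^ 'n::finite ^ 'n"
  assumes "unitary u"
  shows "fun_calc f (u ** real_diag d ** mat_adj u) = u ** real_diag (f \<circ> d) ** mat_adj u"
  unfolding fun_calc_def
proof (rule the_equality)
  show "\<exists>v e. unitary v \<and> u ** real_diag d ** mat_adj u = v ** real_diag e ** mat_adj v
        \<and> u ** real_diag (f \<circ> d) ** mat_adj u = v ** real_diag (f \<circ> e) ** mat_adj v"
    using assms by (intro exI[of _ u] exI[of _ d]) simp
next
  fix b
  assume "\<exists>v e. unitary v \<and> u ** real_diag d ** mat_adj u = v ** real_diag e ** mat_adj v
        \<and> b = v ** real_diag (f \<circ> e) ** mat_adj v"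
  then obtain v e where v: "unitary v"
      "u ** real_diag d ** mat_adj u = v ** real_diag e ** mat_adj v"
    and b: "b = v ** real_diag (f \<circ> e) ** mat_adj v"
    by (elim exE conjE)
  show "b = u ** real_diag (f \<circ> d) ** mat_adj u"
    unfolding b by (rule unitary_diag_unique[OF assms v, symmetric])
qed

definition two_monotone_on :: "real set \<Rightarrow> (real \<Rightarrow> real) \<Rightarrow> bool" where
  "two_monotone_on I f \<longleftrightarrow>
     (\<forall>a b :: complex ^ 2 ^ 2.
        selfadjoint a \<longrightarrow> selfadjoint b \<longrightarrow>
        eigenvalues a \<subseteq> complex_of_real ` I \<longrightarrow> eigenvalues b \<subseteq> complex_of_real ` I \<longrightarrow>
        a \<le>\<^sub>L b \<longrightarrow> fun_calc f a \<le>\<^sub>L fun_calc f b)"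

definition two_convex_on :: "real set \<Rightarrow> (real \<Rightarrow> real) \<Rightarrow> bool" where
  "two_convex_on I f \<longleftrightarrow>
     (\<forall>(a :: complex ^ 2 ^ 2) b. \<forall>l\<in>{0..1::real}.
        selfadjoint a \<longrightarrow> selfadjoint b \<longrightarrow>
        eigenvalues a \<subseteq> complex_of_real ` I \<longrightarrow> eigenvalues b \<subseteq> complex_of_real ` I \<longrightarrow>
        fun_calc f (l *\<^sub>R a + (1 - l) *\<^sub>R b) \<le>\<^sub>L l *\<^sub>R fun_calc f a + (1 - l) *\<^sub>R fun_calc f b)"

end

theory Submission
  imports Defs
begin

text \<open>
  Write \<open>f = a0 + a1 t + \<dots> + a5 t^5\<close>. Test convexity on the matrices with rows \<open>(s, q)\<close> and
  \<open>(q, s + d)\<close> for \<open>d = 2e\<close>, \<open>q = e(\<delta> + \<gamma>e)\<close> and \<open>d = -2e\<close>, \<open>q = e(\<delta> - \<gamma>e)\<close>, and their midpoint: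
  the coefficient of \<open>e^4\<close> in the (1,1) entry shows that the matrix with rows \<open>(f''/2, f'''/6)\<close>
  and \<open>(f'''/6, f''''/24)\<close> is positive semidefinite at every point. Let \<open>D(t)\<close> be its determinant
  and let \<open>E(t) = p' p'''/6 - (p''/2)^2\<close> for \<open>p = a2 t + a3 t^2 + a4 t^3 + a5 t^4\<close>. Then
  \<open>5 E(t) = 4 D(t) + D(0) + 10 t^2 ((a4 + 3 a5 t)^2 + (a5 t)^2)\<close>, so \<open>E\<close> is nonnegative; adding
  \<open>a0 / t\<close>, where \<open>a0 \<le> 0\<close>, keeps the corresponding matrix for \<open>g = f/t\<close> positive semidefinite.

  Conversely, this differential condition says that \<open>c = (g')^(-1/2)\<close> is concave. Comparing \<open>c\<close>
  with a chord compares \<open>g\<close> with a Moebius transformation and gives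
  \<open>g[x1,x2] g[y1,y2] \<ge> g[y1,x1] g[y2,x2]\<close> for divided differences at \<open>y1 < y2 < x1 < x2\<close>.
  For \<open>2 \<times> 2\<close> matrices \<open>a\<close>, \<open>b\<close> with eigenvalues \<open>y1 \<le> x1\<close> and \<open>y2 \<le> x2\<close>, the determinant of
  \<open>b - a\<close> is \<open>(x2 - x1)(y2 - y1) - k (x1 - y1)(x2 - y2)\<close>, where \<open>k \<in> [0,1]\<close> depends only on the
  eigenvectors; so the four-point inequality makes \<open>g\<close> preserve the order.
\<close>

subsection \<open>Four-point inequality\<close>

text \<open>The chord inequality cleared of denominators; rearranged, it also bounds
  \<open>c\<close> from above beyond a chord.\<close>

lemma concave_on_three_points:
  fixes c :: "real \<Rightarrow> real"
  assumes "concave_on I c" "u \<in> I" "w \<in> I" "u < v" "v < w"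
  shows "c u * (w - v) + c w * (v - u) \<le> c v * (w - u)"
proof -
  define l where "l = (v - u) / (w - u)"
  have lw: "l * (w - u) = v - u" and l: "0 \<le> l" "l \<le> 1"
    using assms by (auto simp: l_def)
  then have v: "(1 - l) * u + l * w = v"
    by (simp add: algebra_simps)
  have "(1 - l) * c u + l * c w \<le> c v"
    using concave_onD[OF assms(1) l(1,2) assms(2,3)] v by simp
  then have "((1 - l) * c u + l * c w) * (w - u) \<le> c v * (w - u)"
    using assms by (intro mult_right_mono) auto
  moreover have "((1 - l) * c u + l * c w) * (w - u) = c u * (w - u - l * (w - u)) + c w * (l * (w - u))"
    by (simp add: algebra_simps)
  ultimately show ?thesis
    unfolding lw by simp
qed

text \<open>This is the antiderivative of \<open>1 / (m t + k)^2\<close> that vanishes at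
  \<open>a\<close>. Unlike \<open>-1 / (m (m t + k))\<close>, it also covers
  \<open>m = 0\<close>.\<close>

lemma moebius_deriv:
  fixes m k a t :: real
  assumes "m * t + k \<noteq> 0" "m * a + k \<noteq> 0"
  shows "((\<lambda>t. (t - a) / ((m * a + k) * (m * t + k))) has_real_derivative 1 / (m * t + k)\<^sup>2) (at t)"
  using assms
  by (auto intro!: derivative_eq_intros simp: divide_simps power2_eq_square) (simp add: algebra_simps)

text \<open>The Moebius function \<open>?M\<close> vanishes at \<open>a\<close>, and
  \<open>g - ?M\<close> has nonnegative derivative.\<close>

lemma moebius_difference_le:
  fixes g g' :: "real \<Rightarrow> real" and m k :: real
  assumes "a \<le> b" and g: "\<And>t. t \<in> {a..b} \<Longrightarrow> (g has_real_derivative g' t) (at t)"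
    and pos: "\<And>t. t \<in> {a..b} \<Longrightarrow> 0 < m * t + k"
    and le: "\<And>t. t \<in> {a..b} \<Longrightarrow> 1 / (m * t + k)\<^sup>2 \<le> g' t"
  shows "(b - a) / ((m * a + k) * (m * b + k)) \<le> g b - g a"
proof -
  let ?M = "\<lambda>t. (t - a) / ((m * a + k) * (m * t + k))"
  have "g a - ?M a \<le> g b - ?M b"
  proof (rule DERIV_nonneg_imp_nondecreasing[OF \<open>a \<le> b\<close>])
    fix t assume t: "a \<le> t" "t \<le> b"
    have "((\<lambda>t. g t - ?M t) has_real_derivative g' t - 1 / (m * t + k)\<^sup>2) (at t)"
      using g[of t] pos[of t] pos[of a] t assms(1)
      by (intro DERIV_diff moebius_deriv) auto
    then show "\<exists>y. ((\<lambda>t. g t - ?M t) has_real_derivative y) (at t) \<and> 0 \<le> y"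
      using le[of t] t by (intro exI[of _ "g' t - 1 / (m * t + k)\<^sup>2"]) auto
  qed
  then show ?thesis by simp
qed

lemma moebius_difference_ge:
  fixes g g' :: "real \<Rightarrow> real" and m k :: real
  assumes "a \<le> b" and g: "\<And>t. t \<in> {a..b} \<Longrightarrow> (g has_real_derivative g' t) (at t)"
    and pos: "\<And>t. t \<in> {a..b} \<Longrightarrow> 0 < m * t + k"
    and le: "\<And>t. t \<in> {a..b} \<Longrightarrow> g' t \<le> 1 / (m * t + k)\<^sup>2"
  shows "g b - g a \<le> (b - a) / ((m * a + k) * (m * b + k))"
proof -
  let ?M = "\<lambda>t. (t - a) / ((m * a + k) * (m * t + k))"
  have "?M a - g a \<le> ?M b - g b"
  proof (rule DERIV_nonneg_imp_nondecreasing[OF \<open>a \<le> b\<close>])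
    fix t assume t: "a \<le> t" "t \<le> b"
    have "((\<lambda>t. ?M t - g t) has_real_derivative 1 / (m * t + k)\<^sup>2 - g' t) (at t)"
      using g[of t] pos[of t] pos[of a] t assms(1)
      by (intro DERIV_diff moebius_deriv) auto
    then show "\<exists>y. ((\<lambda>t. ?M t - g t) has_real_derivative y) (at t) \<and> 0 \<le> y"
      using le[of t] t by (intro exI[of _ "1 / (m * t + k)\<^sup>2 - g' t"]) auto
  qed
  then show ?thesis by simp
qed

text \<open>The second derivative is \<open>h^(-5/2) (3 h'^2 - 2 h h'') / 4\<close>. For
  \<open>h = g'\<close> the hypothesis \<open>det\<close> says that the Schwarzian derivative of
  \<open>g\<close> is nonnegative.\<close>

lemma concave_powr_minus_half:
  fixes h h' h'' :: "real \<Rightarrow> real"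
  assumes I: "convex I"
    and h: "\<And>t. t \<in> I \<Longrightarrow> (h has_real_derivative h' t) (at t)"
    and h': "\<And>t. t \<in> I \<Longrightarrow> (h' has_real_derivative h'' t) (at t)"
    and pos: "\<And>t. t \<in> I \<Longrightarrow> 0 < h t"
    and det: "\<And>t. t \<in> I \<Longrightarrow> 3 * (h' t)\<^sup>2 \<le> 2 * h t * h'' t"
  shows "concave_on I (\<lambda>t. h t powr (-1/2))"
proof (rule f''_le0_imp_concave[OF I])
  fix t assume t: "t \<in> I"
  show "((\<lambda>t. h t powr (-1/2)) has_real_derivative - (1/2) * h t powr (-3/2) * h' t) (at t)"
    using h[OF t] pos[OF t]
    by (auto intro!: derivative_eq_intros simp: powr_diff[symmetric])
  show "((\<lambda>t. - (1/2) * h t powr (-3/2) * h' t) has_real_derivative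
      3/4 * h t powr (-5/2) * h' t * h' t - 1/2 * h t powr (-3/2) * h'' t) (at t)"
    using h[OF t] h'[OF t] pos[OF t]
    by (auto intro!: derivative_eq_intros simp: field_simps)
  have "h t powr (-3/2) = h t powr (-5/2) * h t powr 1"
    by (subst powr_add[symmetric]) simp
  then have "h t powr (-3/2) = h t powr (-5/2) * h t"
    using pos[OF t] by simp
  then have "3/4 * h t powr (-5/2) * h' t * h' t - 1/2 * h t powr (-3/2) * h'' t
     = h t powr (-5/2) / 4 * (3 * (h' t)\<^sup>2 - 2 * h t * h'' t)"
    by (simp add: algebra_simps power2_eq_square)
  also have "\<dots> \<le> 0"
    using det[OF t] by (intro mult_nonneg_nonpos) auto
  finally show "3/4 * h t powr (-5/2) * h' t * h' t - 1/2 * h t powr (-3/2) * h'' t \<le> 0" .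
qed

lemma mono_on_if_deriv_nonneg:
  fixes g g' :: "real \<Rightarrow> real"
  assumes I: "convex I" and g: "\<And>t. t \<in> I \<Longrightarrow> (g has_real_derivative g' t) (at t)"
    and nonneg: "\<And>t. t \<in> I \<Longrightarrow> 0 \<le> g' t"
  shows "mono_on I g"
proof (rule mono_onI)
  fix a b assume ab: "a \<in> I" "b \<in> I" "a \<le> b"
  have "\<exists>y. (g has_real_derivative y) (at t) \<and> 0 \<le> y" if "a \<le> t" "t \<le> b" for t
  proof -
    have "t \<in> I" using ab that I by (auto intro: mem_is_interval_1_I simp: is_interval_convex_1)
    then show ?thesis using g nonneg by blast
  qed
  then show "g a \<le> g b"
    by (rule DERIV_nonneg_imp_nondecreasing[OF ab(3)])
qed

text \<open>Interpolate \<open>c\<close> at \<open>y2\<close> and \<open>x1\<close> by an affine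
  function. Concavity puts \<open>c\<close> above it between these points and below it outside, so
  \<open>g\<close> grows at most as fast as the Moebius transformation with derivative
  \<open>1 / (m t + k)^2\<close> on the middle interval and at least as fast on the outer two. For
  that transformation equality holds, since cross ratios are preserved.\<close>

lemma four_point_pos:
  fixes g g1 g2 g3 :: "real \<Rightarrow> real"
  assumes I: "convex I"
    and g: "\<And>t. t \<in> I \<Longrightarrow> (g has_real_derivative g1 t) (at t)"
    and g1: "\<And>t. t \<in> I \<Longrightarrow> (g1 has_real_derivative g2 t) (at t)"
    and g2: "\<And>t. t \<in> I \<Longrightarrow> (g2 has_real_derivative g3 t) (at t)"
    and pos: "\<And>t. t \<in> I \<Longrightarrow> 0 < g1 t"
    and det: "\<And>t. t \<in> I \<Longrightarrow> 3 * (g2 t)\<^sup>2 \<le> 2 * g1 t * g3 t"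
    and ends: "y1 \<in> I" "x2 \<in> I" and order: "y1 < y2" "y2 < x1" "x1 < x2"
  shows "(x2 - x1) * (y2 - y1) * ((g x1 - g y1) * (g x2 - g y2))
       \<le> (g x2 - g x1) * (g y2 - g y1) * ((x1 - y1) * (x2 - y2))"
proof -
  define c where "c t = g1 t powr (-1/2)" for t
  have c: "concave_on I c"
    unfolding c_def by (rule concave_powr_minus_half[OF I g1 g2 pos det])
  have sub: "t \<in> I" if "y1 \<le> t" "t \<le> x2" for t
    using that ends I by (auto intro: mem_is_interval_1_I simp: is_interval_convex_1)
  have cpos: "0 < c t" and csq: "1 / (c t)\<^sup>2 = g1 t" if "t \<in> I" for t
  proof -
    show "0 < c t" using pos[OF that] by (simp add: c_def)
    have "(c t)\<^sup>2 = g1 t powr (-1)"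
      by (simp add: c_def power2_eq_square flip: powr_add)
    then show "1 / (c t)\<^sup>2 = g1 t"
      using pos[OF that] by (simp add: powr_minus_divide)
  qed
  define m where "m = (c x1 - c y2) / (x1 - y2)"
  define k where "k = c y2 - m * y2"
  have m: "m * (x1 - y2) = c x1 - c y2" using order by (simp add: m_def)
  have ly2: "m * y2 + k = c y2" and lx1: "m * x1 + k = c x1"
    using m by (auto simp: k_def algebra_simps)
  have scaled: "(m * t + k) * (x1 - y2) = c y2 * (x1 - t) + c x1 * (t - y2)" for t
  proof -
    have "(m * t + k) * (x1 - y2) = c y2 * (x1 - y2) + (m * (x1 - y2)) * (t - y2)"
      by (simp add: k_def algebra_simps)
    then show ?thesis unfolding m by (simp add: algebra_simps)
  qed
  have inside: "m * t + k \<le> c t" "0 < m * t + k" if "y2 \<le> t" "t \<le> x1" for t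
  proof -
    have "c y2 * (x1 - t) + c x1 * (t - y2) \<le> c t * (x1 - y2)"
      using concave_on_three_points[OF c sub[of y2] sub[of x1], of t] order that
      by (cases "t = y2"; cases "t = x1") auto
    then show "m * t + k \<le> c t"
      using order unfolding scaled[symmetric] by simp
    have "0 < c y2 * (x1 - t) + c x1 * (t - y2)"
      using that order cpos[OF sub, of y2] cpos[OF sub, of x1]
      by (cases "t = y2") (auto intro: add_nonneg_pos)
    then show "0 < m * t + k"
      using order unfolding scaled[symmetric] by (simp add: zero_less_mult_iff)
  qed
  have outside: "c t \<le> m * t + k" "0 < m * t + k" if "y1 \<le> t" "t \<le> x2" "t \<le> y2 \<or> x1 \<le> t" for t
  proof -
    have "c t * (x1 - y2) \<le> c y2 * (x1 - t) + c x1 * (t - y2)"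
    proof (cases "t < y2")
      case True
      then show ?thesis
        using concave_on_three_points[OF c sub[of t] sub[of x1], of y2] order that
        by (auto simp: algebra_simps)
    next
      case False
      show ?thesis
      proof (cases "x1 < t")
        case True
        then show ?thesis
          using concave_on_three_points[OF c sub[of y2] sub[of t], of x1] order that
          by (auto simp: algebra_simps)
      next
        case 2: False
        with False that have "t = y2 \<or> t = x1" by auto
        then show ?thesis by auto
      qed
    qed
    then show "c t \<le> m * t + k"
      using order unfolding scaled[symmetric] by simp
    \<comment> \<open>Outside the middle interval the affine function is positive because it lies
      above \<open>c\<close>.\<close>
    then show "0 < m * t + k" using cpos[OF sub[OF that(1,2)]] by simp
  qed
  define l1 where "l1 = m * y1 + k"
  define l2 where "l2 = m * y2 + k"
  define l3 where "l3 = m * x1 + k"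
  define l4 where "l4 = m * x2 + k"
  have lpos: "0 < l1" "0 < l2" "0 < l3" "0 < l4"
    unfolding l1_def l2_def l3_def l4_def using outside(2) order by auto
  \<comment> \<open>\<open>A\<close>, \<open>B\<close>, \<open>C\<close> are the increments of
    \<open>g\<close> over the three consecutive intervals; \<open>A'\<close>, \<open>B'\<close>,
    \<open>C'\<close> are those of the Moebius transformation.\<close>
  define A where "A = g y2 - g y1"
  define B where "B = g x1 - g y2"
  define C where "C = g x2 - g x1"
  define A' where "A' = (y2 - y1) / (l1 * l2)"
  define B' where "B' = (x1 - y2) / (l2 * l3)"
  define C' where "C' = (x2 - x1) / (l3 * l4)"
  have sq: "1 / (m * t + k)\<^sup>2 \<le> g1 t" if "y1 \<le> t" "t \<le> x2" "t \<le> y2 \<or> x1 \<le> t" for t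
    unfolding csq[OF sub[OF that(1,2)], symmetric]
    using outside[OF that] cpos[OF sub[OF that(1,2)]] by (intro divide_left_mono power_mono) auto
  have A: "A' \<le> A"
    unfolding A'_def A_def l1_def l2_def using order
    by (intro moebius_difference_le[of _ _ g g1] g sub sq outside) auto
  have C: "C' \<le> C"
    unfolding C'_def C_def l3_def l4_def using order
    by (intro moebius_difference_le[of _ _ g g1] g sub sq outside) auto
  have sq': "g1 t \<le> 1 / (m * t + k)\<^sup>2" if "y2 \<le> t" "t \<le> x1" for t
  proof -
    have t: "t \<in> I" using that order by (intro sub) auto
    show ?thesis
      unfolding csq[OF t, symmetric]
      using inside[OF that] cpos[OF t] by (intro divide_left_mono power_mono) auto
  qed
  have B: "B \<le> B'"
    unfolding B'_def B_def l2_def l3_def using order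
    by (intro moebius_difference_ge[of _ _ g g1] g sub sq' inside) auto
  have pos': "0 \<le> A'" "0 \<le> B'" "0 \<le> C'"
    using lpos order by (auto simp: A'_def B'_def C'_def)
  have B0: "0 \<le> B"
    unfolding B_def using mono_onD[OF mono_on_if_deriv_nonneg[OF I g less_imp_le[OF pos]]
      sub[of y2] sub[of x1]] order by simp
  have "A' * B \<le> A * B'" "C' * B \<le> C * B'"
    using A B C pos' B0 by (auto intro: mult_mono)
  \<comment> \<open>That is, \<open>A' / (A' + B') <= A / (A + B)\<close>, and likewise for
    \<open>C\<close>.\<close>
  then have "A' * (A + B) \<le> A * (A' + B')" "C' * (B + C) \<le> C * (B' + C')"
    by (simp_all add: algebra_simps)
  then have "(A' * (A + B)) * (C' * (B + C)) \<le> (A * (A' + B')) * (C * (B' + C'))"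
    by (rule mult_mono) (use A B C pos' B0 in auto)
  \<comment> \<open>The denominators of \<open>A' C'\<close> and of
    \<open>(A' + B') (B' + C')\<close> are both \<open>l1 l2 l3 l4\<close>, so they cancel.\<close>
  moreover have "A' + B' = (x1 - y1) / (l1 * l3)" "B' + C' = (x2 - y2) / (l2 * l4)"
    using lpos by (simp_all add: A'_def B'_def C'_def divide_simps)
      (simp_all add: l1_def l2_def l3_def l4_def algebra_simps)
  ultimately have "((y2 - y1) * (x2 - x1) * ((A + B) * (B + C))) / (l1 * l2 * l3 * l4)
      \<le> (A * C * ((x1 - y1) * (x2 - y2))) / (l1 * l2 * l3 * l4)"
    by (simp add: A'_def C'_def ac_simps)
  then have "(y2 - y1) * (x2 - x1) * ((A + B) * (B + C)) \<le> A * C * ((x1 - y1) * (x2 - y2))"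
    using lpos by (simp add: divide_le_cancel) 
  then show ?thesis
    by (simp add: A_def B_def C_def mult.commute)
qed

text \<open>The case of strict positivity applies to \<open>g + e t\<close>, \<open>e > 0\<close>; then let \<open>e\<close> tend to 0.\<close>

lemma four_point:
  fixes g g1 g2 g3 :: "real \<Rightarrow> real"
  assumes I: "convex I"
    and g: "\<And>t. t \<in> I \<Longrightarrow> (g has_real_derivative g1 t) (at t)"
    and g1: "\<And>t. t \<in> I \<Longrightarrow> (g1 has_real_derivative g2 t) (at t)"
    and g2: "\<And>t. t \<in> I \<Longrightarrow> (g2 has_real_derivative g3 t) (at t)"
    and nonneg: "\<And>t. t \<in> I \<Longrightarrow> 0 \<le> g1 t" "\<And>t. t \<in> I \<Longrightarrow> 0 \<le> g3 t"
    and det: "\<And>t. t \<in> I \<Longrightarrow> 3 * (g2 t)\<^sup>2 \<le> 2 * g1 t * g3 t"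
    and ends: "y1 \<in> I" "x2 \<in> I" and order: "y1 < y2" "y2 < x1" "x1 < x2"
  shows "(x2 - x1) * (y2 - y1) * ((g x1 - g y1) * (g x2 - g y2))
       \<le> (g x2 - g x1) * (g y2 - g y1) * ((x1 - y1) * (x2 - y2))"
proof (rule tendsto_le)
  let ?G = "\<lambda>e t. g t + e * t"
  show "((\<lambda>e. (?G e x2 - ?G e x1) * (?G e y2 - ?G e y1) * ((x1 - y1) * (x2 - y2)))
     \<longlongrightarrow> (g x2 - g x1) * (g y2 - g y1) * ((x1 - y1) * (x2 - y2))) (at_right 0)"
    by (auto intro!: tendsto_eq_intros)
  show "((\<lambda>e. (x2 - x1) * (y2 - y1) * ((?G e x1 - ?G e y1) * (?G e x2 - ?G e y2)))
     \<longlongrightarrow> (x2 - x1) * (y2 - y1) * ((g x1 - g y1) * (g x2 - g y2))) (at_right 0)"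
    by (auto intro!: tendsto_eq_intros)
  have "(x2 - x1) * (y2 - y1) * ((?G e x1 - ?G e y1) * (?G e x2 - ?G e y2))
     \<le> (?G e x2 - ?G e x1) * (?G e y2 - ?G e y1) * ((x1 - y1) * (x2 - y2))" if e: "e > 0" for e
  proof (rule four_point_pos[OF I _ _ g2 _ _ ends order])
    fix t assume t: "t \<in> I"
    show "(?G e has_real_derivative g1 t + e) (at t)"
      using g[OF t] by (auto intro!: derivative_eq_intros)
    show "((\<lambda>t. g1 t + e) has_real_derivative g2 t) (at t)"
      using g1[OF t] by (auto intro!: derivative_eq_intros)
    show "0 < g1 t + e" using nonneg(1)[OF t] e by simp
    \<comment> \<open>Replacing \<open>g1\<close> by \<open>g1 + e\<close> adds exactly this term to
      the right-hand side of the determinant condition.\<close>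
    have "0 \<le> 2 * e * g3 t" using nonneg(2)[OF t] e by simp
    then show "3 * (g2 t)\<^sup>2 \<le> 2 * (g1 t + e) * g3 t"
      using det[OF t] by (simp add: algebra_simps)
  qed
  then show "\<forall>\<^sub>F e in at_right 0. (x2 - x1) * (y2 - y1) * ((?G e x1 - ?G e y1) * (?G e x2 - ?G e y2))
     \<le> (?G e x2 - ?G e x1) * (?G e y2 - ?G e y1) * ((x1 - y1) * (x2 - y2))"
    by (auto simp: eventually_at_filter)
qed simp

subsection \<open>Selfadjoint two by two matrices\<close>

definition herm2 :: "real \<Rightarrow> complex \<Rightarrow> real \<Rightarrow> complex ^ 2 ^ 2" where
  "herm2 p c r = vector [vector [complex_of_real p, c], vector [cnj c, complex_of_real r]]"

lemma herm2_nth [simp]: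
  "herm2 p c r $ 1 $ 1 = complex_of_real p" "herm2 p c r $ 1 $ 2 = c"
  "herm2 p c r $ 2 $ 1 = cnj c" "herm2 p c r $ 2 $ 2 = complex_of_real r"
  by (simp_all add: herm2_def)

lemma herm2_eq_iff: "herm2 p c r = herm2 p' c' r' \<longleftrightarrow> p = p' \<and> c = c' \<and> r = r'"
  by (auto simp: vec_eq_iff forall_2)

lemma herm2_diff: "herm2 p c r - herm2 p' c' r' = herm2 (p - p') (c - c') (r - r')"
  by (simp add: vec_eq_iff forall_2)

lemma selfadjoint_herm2: "selfadjoint (herm2 p c r)"
  by (simp add: selfadjoint_def mat_adj_def vec_eq_iff forall_2)

lemma selfadjoint_2_cases:
  fixes a :: "complex ^ 2 ^ 2"
  assumes "selfadjoint a"
  obtains p c r where "a = herm2 p c r"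
proof -
  have sa: "cnj (a $ j $ i) = a $ i $ j" for i j
    using assms by (simp add: selfadjoint_def mat_adj_def vec_eq_iff)
  have "a $ i $ i = complex_of_real (Re (a $ i $ i))" for i
    using sa[of i i] by (metis Reals_cnj_iff of_real_Re)
  then have "a = herm2 (Re (a $ 1 $ 1)) (a $ 1 $ 2) (Re (a $ 2 $ 2))"
    using sa[of 1 2] by (simp add: vec_eq_iff forall_2)
  then show thesis by (rule that)
qed

lemma quadratic_form_herm2:
  "(\<Sum>i\<in>UNIV. cnj (x $ i) * (herm2 p c r *v x) $ i)
     = cnj (x $ 1) * (p * x $ 1 + c * x $ 2) + cnj (x $ 2) * (cnj c * x $ 1 + r * x $ 2)"
  by (simp add: matrix_vector_mult_def sum_2)

lemma Re_quadratic_form_herm2: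
  "Re (\<Sum>i\<in>UNIV. cnj (x $ i) * (herm2 p c r *v x) $ i)
     = p * (cmod (x $ 1))\<^sup>2 + r * (cmod (x $ 2))\<^sup>2 + 2 * Re (cnj (x $ 1) * c * x $ 2)"
  unfolding quadratic_form_herm2 cmod_power2 by (simp add: algebra_simps power2_eq_square)

text \<open>The conditions are on trace and determinant. One direction tests the form on suitable
  vectors, the other is the arithmetic-geometric mean inequality.\<close>

lemma positive_semidef_herm2_iff:
  "positive_semidef (herm2 p c r) \<longleftrightarrow> 0 \<le> p + r \<and> (cmod c)\<^sup>2 \<le> p * r"
proof
  assume "positive_semidef (herm2 p c r)"
  then have "0 \<le> Re (\<Sum>i\<in>UNIV. cnj (x $ i) * (herm2 p c r *v x) $ i)" for x
    by (simp add: positive_semidef_def)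
  then have form: "0 \<le> p * (cmod z)\<^sup>2 + r * (cmod w)\<^sup>2 + 2 * Re (cnj z * c * w)" for z w
    unfolding Re_quadratic_form_herm2 by (metis vector_2)
  have p: "0 \<le> p" and r: "0 \<le> r"
    using form[of 1 0] form[of 0 1] by auto
  have "(cmod c)\<^sup>2 \<le> p * r"
  proof (cases "p = 0")
    case True
    have "c = 0"
    proof (rule ccontr)
      assume "c \<noteq> 0"
      have "cnj c * c = (cmod c)\<^sup>2"
        by (metis complex_norm_square mult.commute)
      \<comment> \<open>With this as first entry and 1 as second, the form for \<open>p = 0\<close>
        equals \<open>r - 2 (r + 1)\<close>, which is negative.\<close>
      then have "Re (cnj (- (((r + 1) / (cmod c)\<^sup>2) * c)) * c) = - (r + 1)"
        using \<open>c \<noteq> 0\<close> by (simp add: mult.assoc del: Re_divide_of_real)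
      then show False
        using form[of "- (((r + 1) / (cmod c)\<^sup>2) * c)" 1] True r by simp
    qed
    then show ?thesis using True by simp
  next
    case False
    \<comment> \<open>The test vector \<open>(c, -p)\<close> gives \<open>p\<close> times the
      determinant.\<close>
    have "0 \<le> p * (p * r - (cmod c)\<^sup>2)"
      using form[of c "- p"] unfolding norm_minus_cancel norm_of_real
      by (simp add: algebra_simps power2_eq_square flip: cmod_power2) (simp add: cmod_power2[unfolded power2_eq_square] algebra_simps)
    then show ?thesis using False p by (simp add: zero_le_mult_iff)
  qed
  then show "0 \<le> p + r \<and> (cmod c)\<^sup>2 \<le> p * r" using p r by simp
next
  assume *: "0 \<le> p + r \<and> (cmod c)\<^sup>2 \<le> p * r"
  then have "0 \<le> p * r" by (meson order_trans zero_le_power2)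
  with * have p: "0 \<le> p" and r: "0 \<le> r" by (auto simp: zero_le_mult_iff)
  have "0 \<le> p * (cmod z)\<^sup>2 + r * (cmod w)\<^sup>2 + 2 * Re (cnj z * c * w)" for z w
  proof -
    have "(2 * (cmod c * (cmod z * cmod w)))\<^sup>2 = 4 * (cmod c)\<^sup>2 * (cmod z * cmod w)\<^sup>2"
      by (simp add: power_mult_distrib)
    also have "\<dots> \<le> 4 * (p * r) * (cmod z * cmod w)\<^sup>2"
      using * by (intro mult_right_mono) auto
    also have "\<dots> = (p * (cmod z)\<^sup>2 + r * (cmod w)\<^sup>2)\<^sup>2 - (p * (cmod z)\<^sup>2 - r * (cmod w)\<^sup>2)\<^sup>2"
      by (simp add: power2_eq_square algebra_simps)
    also have "\<dots> \<le> (p * (cmod z)\<^sup>2 + r * (cmod w)\<^sup>2)\<^sup>2" by simp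
    finally have "2 * (cmod c * (cmod z * cmod w)) \<le> p * (cmod z)\<^sup>2 + r * (cmod w)\<^sup>2"
      by (rule power2_le_imp_le) (use p r in simp)
    moreover have "- Re (cnj z * c * w) \<le> cmod c * (cmod z * cmod w)"
      using abs_Re_le_cmod[of "cnj z * c * w"] by (simp add: norm_mult mult.assoc mult.left_commute)
    ultimately show ?thesis by linarith
  qed
  then show "positive_semidef (herm2 p c r)"
    unfolding positive_semidef_def Re_quadratic_form_herm2 by (simp only: selfadjoint_herm2 simp_thms)
qed

lemma ex_2: "(\<exists>i::2. P i) \<longleftrightarrow> P 1 \<or> P 2"
  using forall_2[of "\<lambda>i. \<not> P i"] by blast

lemma eigenvalues_unitary_diag:
  fixes u :: "complex ^ 'n::finite ^ 'n"
  assumes "unitary u"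
  shows "eigenvalues (u ** real_diag d ** mat_adj u) = complex_of_real ` range d"
proof -
  have u: "mat_adj u ** u = mat 1" "u ** mat_adj u = mat 1"
    using assms by (auto simp: unitary_def)
  have D: "(real_diag d *v w) $ i = d i * w $ i" for w :: "complex ^ 'n" and i
    by (simp add: matrix_vector_mult_def real_diag_def if_distrib if_distribR cong: if_cong)
  have 1: "\<exists>i. z = complex_of_real (d i)"
    if v: "v \<noteq> 0" "(u ** real_diag d ** mat_adj u) *v v = z *s v" for z v
  proof -
    let ?w = "mat_adj u *v v"
    have "u *v ?w = v" by (simp add: matrix_vector_mul_assoc u)
    then have "?w \<noteq> 0" using v(1) by (metis matrix_vector_mult_0_right)
    then obtain i where i: "?w $ i \<noteq> 0" by (auto simp: vec_eq_iff)
    have "real_diag d *v ?w = mat_adj u *v ((u ** real_diag d ** mat_adj u) *v v)"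
      by (simp add: matrix_vector_mul_assoc matrix_mul_assoc u)
    also have "\<dots> = z *s ?w"
      by (simp add: v(2) vector_scalar_commute)
    finally have "d i * ?w $ i = z * ?w $ i"
      unfolding vec_eq_iff D by simp
    then show ?thesis using i by auto
  qed
  have 2: "\<exists>v. v \<noteq> 0 \<and> (u ** real_diag d ** mat_adj u) *v v = complex_of_real (d i) *s v" for i
  proof (intro exI conjI)
    let ?e = "axis i 1 :: complex ^ 'n"
    have e: "mat_adj u *v (u *v ?e) = ?e"
      by (simp add: matrix_vector_mul_assoc u)
    show "u *v ?e \<noteq> 0"
      using e by (metis axis_eq_0_iff matrix_vector_mult_0_right zero_neq_one)
    have "real_diag d *v ?e = complex_of_real (d i) *s ?e"
      unfolding vec_eq_iff D by (simp add: axis_def)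
    then show "(u ** real_diag d ** mat_adj u) *v (u *v ?e) = complex_of_real (d i) *s (u *v ?e)"
      using e by (simp flip: matrix_vector_mul_assoc add: vector_scalar_commute)
  qed
  have "(\<exists>v. v \<noteq> 0 \<and> (u ** real_diag d ** mat_adj u) *v v = z *s v) \<longleftrightarrow> (\<exists>i. z = complex_of_real (d i))" for z
    using 1[of _ z] 2 by blast
  then show ?thesis
    by (simp add: eigenvalues_def set_eq_iff image_iff)
qed

text \<open>A unit eigenvector \<open>(v, w)\<close> for the larger root \<open>x\<close> is
  completed to a unitary matrix by \<open>(- cnj w, cnj v)\<close>, whose eigenvalue is
  \<open>y\<close> because the trace is \<open>x + y\<close>.\<close>

lemma herm2_diagonalization:
  obtains u x y where "unitary u" "y \<le> x"
    "herm2 p c r = u ** real_diag (\<lambda>i. if i = 1 then x else y) ** mat_adj u"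
proof -
  define s where "s = sqrt (((p - r) / 2)\<^sup>2 + (cmod c)\<^sup>2)"
  define x where "x = (p + r) / 2 + s"
  define y where "y = (p + r) / 2 - s"
  have s: "0 \<le> s" "s\<^sup>2 = ((p - r) / 2)\<^sup>2 + (cmod c)\<^sup>2" by (auto simp: s_def)
  have xpr: "(x - p) * (x - r) = (cmod c)\<^sup>2"
    using s(2) by (simp add: x_def power2_eq_square field_simps)
  have cc: "cnj c * c = complex_of_real ((cmod c)\<^sup>2)"
    by (metis complex_norm_square mult.commute)
  obtain v w :: complex where vw: "v * cnj v + w * cnj w = 1" "p * v + c * w = x * v" "cnj c * v + r * w = x * w"
  \<comment> \<open>The eigenvector \<open>(c, x - p)\<close> can vanish if \<open>c = 0\<close>, so
    the diagonal case is separate.\<close>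
  proof (cases "c = 0")
    case True
    then have "x = p \<or> x = r" using xpr by auto
    then show thesis using True that[of 1 0] that[of 0 1] by auto
  next
    case False
    define n where "n = sqrt ((cmod c)\<^sup>2 + (x - p)\<^sup>2)"
    have n: "n > 0" "n\<^sup>2 = (cmod c)\<^sup>2 + (x - p)\<^sup>2"
      using False by (auto simp: n_def intro: add_pos_nonneg)
    define v where "v = c / complex_of_real n"
    define w where "w = complex_of_real (x - p) / complex_of_real n"
    have "v * cnj v + w * cnj w = complex_of_real ((cmod c)\<^sup>2 + (x - p)\<^sup>2) / complex_of_real (n\<^sup>2)"
      using cc by (simp add: v_def w_def add_divide_distrib power2_eq_square mult.commute)
    also have "\<dots> = 1" using n(1) unfolding n(2)[symmetric] by simp
    finally have 1: "v * cnj v + w * cnj w = 1" .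
    have 2: "p * v + c * w = x * v"
      using n by (simp add: v_def w_def field_simps)
    have "cnj c * c + complex_of_real (r * (x - p)) = complex_of_real (x * (x - p))"
      unfolding cc xpr[symmetric] of_real_add[symmetric] of_real_eq_iff by (simp add: algebra_simps)
    then have 3: "cnj c * v + r * w = x * w"
      by (simp add: v_def w_def add_divide_distrib[symmetric])
    show thesis using 1 2 3 by (rule that)
  qed
  define u :: "complex ^ 2 ^ 2" where
    "u = vector [vector [v, - cnj w], vector [w, cnj v]]"
  have u: "unitary u"
    using vw(1)
    by (simp add: unitary_def mat_adj_def matrix_matrix_mult_def vec_eq_iff forall_2 sum_2 u_def
        mat_def algebra_simps)
  have vw': "p * cnj v + cnj c * cnj w = x * cnj v" "c * cnj v + r * cnj w = x * cnj w"
    using arg_cong[OF vw(2), of cnj] arg_cong[OF vw(3), of cnj] by simp_all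
  have xy: "p + r - x = y" by (simp add: x_def y_def)
  have "herm2 p c r ** u = u ** real_diag (\<lambda>i. if i = 1 then x else y)"
    using vw(2,3) vw'
    by (simp add: matrix_matrix_mult_def vec_eq_iff forall_2 sum_2 u_def real_diag_def
        algebra_simps flip: xy)
  then have "herm2 p c r ** (u ** mat_adj u) = u ** real_diag (\<lambda>i. if i = 1 then x else y) ** mat_adj u"
    by (simp add: matrix_mul_assoc)
  then have "herm2 p c r = u ** real_diag (\<lambda>i. if i = 1 then x else y) ** mat_adj u"
    using u by (simp add: unitary_def)
  moreover have "y \<le> x" using s(1) by (simp add: x_def y_def)
  ultimately show thesis using u by (intro that)
qed

text \<open>The matrix \<open>P\<close> with rows \<open>(p, \<rho>)\<close> and
  \<open>(cnj \<rho>, 1 - p)\<close> is a spectral projection for \<open>x\<close>, and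
  \<open>g(a) = g(y) + (g(x) - g(y)) P\<close> with the same \<open>P\<close> for every
  \<open>g\<close>. The condition on \<open>\<rho>\<close> is \<open>det P = 0\<close>.\<close>

lemma selfadjoint_2_spectral:
  fixes a :: "complex ^ 2 ^ 2"
  assumes "selfadjoint a"
  obtains x y p \<rho> where "y \<le> x" "eigenvalues a = {complex_of_real x, complex_of_real y}"
    "0 \<le> p" "p \<le> 1" "(cmod \<rho>)\<^sup>2 = p * (1 - p)"
    "\<And>g. fun_calc g a = herm2 (g y + (g x - g y) * p) (of_real (g x - g y) * \<rho>) (g x - (g x - g y) * p)"
proof -
  obtain p0 c r where a: "a = herm2 p0 c r"
    using assms by (rule selfadjoint_2_cases)
  obtain u x y where u: "unitary u" and yx: "y \<le> x"
    and a': "a = u ** real_diag (\<lambda>i. if i = 1 then x else y) ** mat_adj u"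
    unfolding a by (rule herm2_diagonalization)
  have U: "u $ 1 $ 1 * cnj (u $ 1 $ 1) + u $ 1 $ 2 * cnj (u $ 1 $ 2) = 1"
      "u $ 2 $ 1 * cnj (u $ 2 $ 1) + u $ 2 $ 2 * cnj (u $ 2 $ 2) = 1"
      "u $ 1 $ 1 * cnj (u $ 2 $ 1) + u $ 1 $ 2 * cnj (u $ 2 $ 2) = 0"
      "u $ 2 $ 1 * cnj (u $ 1 $ 1) + u $ 2 $ 2 * cnj (u $ 1 $ 2) = 0"
      "u $ 1 $ 1 * cnj (u $ 1 $ 1) + u $ 2 $ 1 * cnj (u $ 2 $ 1) = 1"
    using u by (auto simp: unitary_def mat_adj_def matrix_matrix_mult_def vec_eq_iff forall_2 sum_2
        mat_def mult.commute)
  define p where "p = (cmod (u $ 1 $ 1))\<^sup>2"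
  define \<rho> where "\<rho> = u $ 1 $ 1 * cnj (u $ 2 $ 1)"
  have u11: "u $ 1 $ 1 * cnj (u $ 1 $ 1) = p"
    unfolding p_def by (metis complex_norm_square)
  then have u12: "u $ 1 $ 2 * cnj (u $ 1 $ 2) = 1 - p"
    and u21: "u $ 2 $ 1 * cnj (u $ 2 $ 1) = 1 - p"
    using U(1,5) by (simp_all add: algebra_simps)
  then have u22: "u $ 2 $ 2 * cnj (u $ 2 $ 2) = p"
    using U(2) by simp
  have q: "(cmod (u $ 2 $ 1))\<^sup>2 = 1 - p"
    using u21 by (metis complex_norm_square of_real_1 of_real_diff of_real_eq_iff)
  have \<rho>: "(cmod \<rho>)\<^sup>2 = p * (1 - p)"
    using q by (simp add: \<rho>_def norm_mult power_mult_distrib p_def)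
  have p0: "0 \<le> p" by (simp add: p_def)
  have p1: "p \<le> 1" using q zero_le_power2[of "cmod (u $ 2 $ 1)"] by linarith
  have ev: "eigenvalues a = {complex_of_real x, complex_of_real y}"
    unfolding a' eigenvalues_unitary_diag[OF u] by (auto simp: image_def ex_2)
  have fc: "fun_calc g a
     = herm2 (g y + (g x - g y) * p) (of_real (g x - g y) * \<rho>) (g x - (g x - g y) * p)" for g
  proof -
    have e: "fun_calc g a $ i $ j = u $ i $ 1 * cnj (u $ j $ 1) * g x + u $ i $ 2 * cnj (u $ j $ 2) * g y" for i j
      unfolding a' fun_calc_eq[OF u]
      by (simp add: matrix_matrix_mult_def sum_2 real_diag_def mat_adj_def)
    have \<rho>12: "u $ 1 $ 2 * cnj (u $ 2 $ 2) = - \<rho>" and \<rho>21: "u $ 2 $ 1 * cnj (u $ 1 $ 1) = cnj \<rho>"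
      using U(3) by (simp_all add: \<rho>_def add_eq_0_iff mult.commute)
    have \<rho>22: "u $ 2 $ 2 * cnj (u $ 1 $ 2) = - cnj \<rho>"
      using U(4) unfolding \<rho>21 by (simp add: add_eq_0_iff)
    show ?thesis
      unfolding vec_eq_iff forall_2 e u11 u12 u21 u22 \<rho>12 \<rho>21 \<rho>22
      by (simp add: \<rho>_def[symmetric] algebra_simps)
  qed
  show thesis by (rule that[OF yx ev p0 p1 \<rho> fc])
qed

lemma fun_calc_id:
  fixes a :: "complex ^ 2 ^ 2"
  assumes "selfadjoint a"
  shows "fun_calc (\<lambda>t. t) a = a"
proof -
  obtain p c r where a: "a = herm2 p c r"
    using assms by (rule selfadjoint_2_cases)
  obtain u x y where u: "unitary u"
    and a': "a = u ** real_diag (\<lambda>i. if i = 1 then x else y) ** mat_adj u"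
    unfolding a by (rule herm2_diagonalization)
  show ?thesis unfolding a' fun_calc_eq[OF u] by (simp add: comp_def)
qed

subsection \<open>Matrix monotonicity\<close>

text \<open>Trace and determinant of the difference; the factor in the second condition is
  \<open>1 - tr (P Q)\<close> for the two projections. The reals are arbitrary, so values of
  \<open>g\<close> may replace the eigenvalues.\<close>

lemma herm2_difference_positive_semidef_iff:
  fixes x1 x2 y1 y2 p q :: real and \<rho> \<sigma> :: complex
  assumes \<rho>: "(cmod \<rho>)\<^sup>2 = p * (1 - p)" and \<sigma>: "(cmod \<sigma>)\<^sup>2 = q * (1 - q)"
  shows "positive_semidef
      (herm2 (y2 + (x2 - y2) * q) (of_real (x2 - y2) * \<sigma>) (x2 - (x2 - y2) * q)
       - herm2 (y1 + (x1 - y1) * p) (of_real (x1 - y1) * \<rho>) (x1 - (x1 - y1) * p))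
    \<longleftrightarrow> 0 \<le> (x2 - x1) + (y2 - y1) \<and>
      (p * (1 - q) + q * (1 - p) - 2 * Re (\<rho> * cnj \<sigma>)) * ((x1 - y1) * (x2 - y2))
        \<le> (x2 - x1) * (y2 - y1)"
proof -
  have norm: "(cmod (of_real \<beta> * \<sigma> - of_real \<gamma> * \<rho>))\<^sup>2
     = \<beta>\<^sup>2 * (q * (1 - q)) + \<gamma>\<^sup>2 * (p * (1 - p)) - 2 * \<beta> * \<gamma> * Re (\<rho> * cnj \<sigma>)" for \<beta> \<gamma>
    unfolding \<rho>[symmetric] \<sigma>[symmetric] cmod_power2
    by (simp add: power2_eq_square algebra_simps)
  have "(y2 + (x2 - y2) * q - (y1 + (x1 - y1) * p)) * (x2 - (x2 - y2) * q - (x1 - (x1 - y1) * p))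
      - (cmod (of_real (x2 - y2) * \<sigma> - of_real (x1 - y1) * \<rho>))\<^sup>2
    = (x2 - x1) * (y2 - y1)
      - (p * (1 - q) + q * (1 - p) - 2 * Re (\<rho> * cnj \<sigma>)) * ((x1 - y1) * (x2 - y2))"
    unfolding norm by algebra
  moreover have "(y2 + (x2 - y2) * q - (y1 + (x1 - y1) * p)) + (x2 - (x2 - y2) * q - (x1 - (x1 - y1) * p))
     = (x2 - x1) + (y2 - y1)"
    by simp
  ultimately show ?thesis
    unfolding herm2_diff positive_semidef_herm2_iff by linarith
qed

text \<open>Both bounds combine \<open>|Re (\<rho> cnj \<sigma>)| \<le> |\<rho>| |\<sigma>|\<close>
  with the arithmetic-geometric mean inequality, for the factors \<open>p (1 - q)\<close>,
  \<open>q (1 - p)\<close> and for \<open>p q\<close>, \<open>(1 - p) (1 - q)\<close>.\<close>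

lemma spectral_overlap_bounds:
  fixes p q :: real and \<rho> \<sigma> :: complex
  assumes p: "0 \<le> p" "p \<le> 1" and q: "0 \<le> q" "q \<le> 1"
    and \<rho>: "(cmod \<rho>)\<^sup>2 = p * (1 - p)" and \<sigma>: "(cmod \<sigma>)\<^sup>2 = q * (1 - q)"
  shows "0 \<le> p * (1 - q) + q * (1 - p) - 2 * Re (\<rho> * cnj \<sigma>)"
    and "p * (1 - q) + q * (1 - p) - 2 * Re (\<rho> * cnj \<sigma>) \<le> 1"
proof -
  have sq: "(2 * (cmod \<rho> * cmod \<sigma>))\<^sup>2 = 4 * (p * (1 - p) * (q * (1 - q)))"
    by (simp add: power_mult_distrib \<rho> \<sigma>)
  have "4 * (p * (1 - p) * (q * (1 - q))) = (p * (1 - q) + q * (1 - p))\<^sup>2 - (p * (1 - q) - q * (1 - p))\<^sup>2"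
    by (simp add: power2_eq_square algebra_simps)
  then have "(2 * (cmod \<rho> * cmod \<sigma>))\<^sup>2 \<le> (p * (1 - q) + q * (1 - p))\<^sup>2"
    unfolding sq by simp
  then have 1: "2 * (cmod \<rho> * cmod \<sigma>) \<le> p * (1 - q) + q * (1 - p)"
    by (rule power2_le_imp_le) (use p q in simp)
  have "4 * (p * (1 - p) * (q * (1 - q))) = (p * q + (1 - p) * (1 - q))\<^sup>2 - (p * q - (1 - p) * (1 - q))\<^sup>2"
    by (simp add: power2_eq_square algebra_simps)
  then have "(2 * (cmod \<rho> * cmod \<sigma>))\<^sup>2 \<le> (p * q + (1 - p) * (1 - q))\<^sup>2"
    unfolding sq by simp
  then have 2: "2 * (cmod \<rho> * cmod \<sigma>) \<le> p * q + (1 - p) * (1 - q)"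
    by (rule power2_le_imp_le) (use p q in simp)
  have "\<bar>Re (\<rho> * cnj \<sigma>)\<bar> \<le> cmod \<rho> * cmod \<sigma>"
    using abs_Re_le_cmod[of "\<rho> * cnj \<sigma>"] by (simp add: norm_mult)
  with 1 2 show "0 \<le> p * (1 - q) + q * (1 - p) - 2 * Re (\<rho> * cnj \<sigma>)"
    and "p * (1 - q) + q * (1 - p) - 2 * Re (\<rho> * cnj \<sigma>) \<le> 1"
    by (simp_all add: abs_le_iff algebra_simps)
qed

text \<open>The overlap \<open>k\<close> is the same for \<open>a\<close>, \<open>b\<close> as for
  \<open>g(a)\<close>, \<open>g(b)\<close>; the four-point inequality turns the determinant
  condition of the first pair into that of the second.\<close>

lemma two_monotone_on_if_four_point:
  assumes mono: "mono_on I g"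
    and four_point: "\<And>y1 y2 x1 x2. \<lbrakk>y1 \<in> I; y2 \<in> I; x1 \<in> I; x2 \<in> I; y1 < y2; y2 < x1; x1 < x2\<rbrakk>
      \<Longrightarrow> (x2 - x1) * (y2 - y1) * ((g x1 - g y1) * (g x2 - g y2))
       \<le> (g x2 - g x1) * (g y2 - g y1) * ((x1 - y1) * (x2 - y2))"
  shows "two_monotone_on I g"
  unfolding two_monotone_on_def loewner_le_def
proof (intro allI impI)
  fix a b :: "complex ^ 2 ^ 2"
  assume a: "selfadjoint a" and b: "selfadjoint b"
    and ea: "eigenvalues a \<subseteq> complex_of_real ` I" and eb: "eigenvalues b \<subseteq> complex_of_real ` I"
    and ab: "positive_semidef (b - a)"
  obtain x1 y1 p \<rho> where A: "y1 \<le> x1" "eigenvalues a = {complex_of_real x1, complex_of_real y1}"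
    "0 \<le> p" "p \<le> 1" "(cmod \<rho>)\<^sup>2 = p * (1 - p)"
    and fa: "\<And>g. fun_calc g a = herm2 (g y1 + (g x1 - g y1) * p) (of_real (g x1 - g y1) * \<rho>) (g x1 - (g x1 - g y1) * p)"
    using a by (rule selfadjoint_2_spectral) blast
  obtain x2 y2 q \<sigma> where B: "y2 \<le> x2" "eigenvalues b = {complex_of_real x2, complex_of_real y2}"
    "0 \<le> q" "q \<le> 1" "(cmod \<sigma>)\<^sup>2 = q * (1 - q)"
    and fb: "\<And>g. fun_calc g b = herm2 (g y2 + (g x2 - g y2) * q) (of_real (g x2 - g y2) * \<sigma>) (g x2 - (g x2 - g y2) * q)"
    using b by (rule selfadjoint_2_spectral) blast
  have I: "x1 \<in> I" "y1 \<in> I" "x2 \<in> I" "y2 \<in> I"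
    using ea eb unfolding A(2) B(2) by auto
  \<comment> \<open>\<open>k = 1 - tr (P Q)\<close> for the spectral projections \<open>P\<close>, \<open>Q\<close> of the larger eigenvalues\<close>
  define k where "k = p * (1 - q) + q * (1 - p) - 2 * Re (\<rho> * cnj \<sigma>)"
  have k: "0 \<le> k" "k \<le> 1"
    unfolding k_def by (rule spectral_overlap_bounds[OF A(3,4) B(3,4) A(5) B(5)])+
  have "positive_semidef (fun_calc (\<lambda>t. t) b - fun_calc (\<lambda>t. t) a)"
    using ab a b by (simp add: fun_calc_id)
  then have tr: "0 \<le> (x2 - x1) + (y2 - y1)"
    and det: "k * ((x1 - y1) * (x2 - y2)) \<le> (x2 - x1) * (y2 - y1)"
    unfolding fa fb herm2_difference_positive_semidef_iff[OF A(5) B(5)] k_def by auto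
  have "0 \<le> k * ((x1 - y1) * (x2 - y2))"
    using k A(1) B(1) by simp
  then have "0 \<le> (x2 - x1) * (y2 - y1)" using det by linarith
  \<comment> \<open>Two reals with nonnegative sum and product are nonnegative.\<close>
  then have x: "x1 \<le> x2" and y: "y1 \<le> y2"
    using tr by (auto simp: zero_le_mult_iff)
  have g: "g x1 \<le> g x2" "g y1 \<le> g y2" "g y1 \<le> g x1" "g y2 \<le> g x2"
    using mono I x y A(1) B(1) by (auto dest: mono_onD)
  have nn: "0 \<le> (g x1 - g y1) * (g x2 - g y2)" "0 \<le> (g x2 - g x1) * (g y2 - g y1)"
    using g by simp_all
  have "k * ((g x1 - g y1) * (g x2 - g y2)) \<le> (g x2 - g x1) * (g y2 - g y1)"
  proof (cases "x1 \<le> y2")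
    case True
    have "g x1 \<le> g y2" "g y1 \<le> g x2"
      using mono I True A(1) x B(1) by (auto dest: mono_onD)
    \<comment> \<open>This product is
      \<open>(g x2 - g x1) (g y2 - g y1) - (g x1 - g y1) (g x2 - g y2)\<close>, so here
      \<open>k \<le> 1\<close> suffices.\<close>
    then have "0 \<le> (g x2 - g y1) * (g y2 - g x1)" by simp
    then have "(g x1 - g y1) * (g x2 - g y2) \<le> (g x2 - g x1) * (g y2 - g y1)"
      by (simp add: algebra_simps)
    moreover have "k * ((g x1 - g y1) * (g x2 - g y2)) \<le> 1 * ((g x1 - g y1) * (g x2 - g y2))"
      using k nn by (intro mult_right_mono) auto
    ultimately show ?thesis by simp
  next
    case False
    have *: "(x2 - x1) * (y2 - y1) * ((g x1 - g y1) * (g x2 - g y2))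
       \<le> (g x2 - g x1) * (g y2 - g y1) * ((x1 - y1) * (x2 - y2))"
    proof (cases "y1 = y2 \<or> x1 = x2")
      case True
      then show ?thesis by auto
    next
      case 2: False
      then show ?thesis using False x y I by (intro four_point) auto
    qed
    have pos: "0 < (x1 - y1) * (x2 - y2)"
      using False x y by simp
    have "k * ((g x1 - g y1) * (g x2 - g y2)) * ((x1 - y1) * (x2 - y2))
       = k * ((x1 - y1) * (x2 - y2)) * ((g x1 - g y1) * (g x2 - g y2))"
      by (simp only: ac_simps)
    also have "\<dots> \<le> (x2 - x1) * (y2 - y1) * ((g x1 - g y1) * (g x2 - g y2))"
      using det nn(1) by (rule mult_right_mono)
    also note *
    finally show ?thesis using pos by (simp only: mult_le_cancel_right_pos)
  qed
  then show "positive_semidef (fun_calc g b - fun_calc g a)"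
    unfolding fa fb herm2_difference_positive_semidef_iff[OF A(5) B(5)] k_def using g by simp
qed

lemma two_monotone_onI_deriv:
  fixes g g1 g2 g3 :: "real \<Rightarrow> real"
  assumes I: "convex I"
    and g: "\<And>t. t \<in> I \<Longrightarrow> (g has_real_derivative g1 t) (at t)"
    and g1: "\<And>t. t \<in> I \<Longrightarrow> (g1 has_real_derivative g2 t) (at t)"
    and g2: "\<And>t. t \<in> I \<Longrightarrow> (g2 has_real_derivative g3 t) (at t)"
    and nonneg: "\<And>t. t \<in> I \<Longrightarrow> 0 \<le> g1 t" "\<And>t. t \<in> I \<Longrightarrow> 0 \<le> g3 t"
    and det: "\<And>t. t \<in> I \<Longrightarrow> 3 * (g2 t)\<^sup>2 \<le> 2 * g1 t * g3 t"
  shows "two_monotone_on I g"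
proof (rule two_monotone_on_if_four_point)
  show "mono_on I g"
    by (rule mono_on_if_deriv_nonneg[OF I g nonneg(1)])
qed (rule four_point[OF I g g1 g2 nonneg det])

subsection \<open>Matrix convexity of quintic polynomials\<close>

text \<open>
  The (1,1) entry of \<open>g(a)\<close> integrates \<open>g\<close> against a two-point probability measure, so for
  polynomials \<open>g\<close> it is determined by moments satisfying a two-term recursion.
\<close>

lemma real_herm2_spectral_measure:
  obtains X Y p where
    "eigenvalues (herm2 s (complex_of_real q) (s + d)) = {complex_of_real (s + X), complex_of_real (s + Y)}"
    "X\<^sup>2 = d * X + q\<^sup>2" "Y\<^sup>2 = d * Y + q\<^sup>2" "p * X + (1 - p) * Y = 0"
    "\<And>g. Re (fun_calc g (herm2 s (complex_of_real q) (s + d)) $ 1 $ 1) = p * g (s + X) + (1 - p) * g (s + Y)"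
proof -
  let ?a = "herm2 s (complex_of_real q) (s + d)"
  obtain x y p \<rho> where A: "eigenvalues ?a = {complex_of_real x, complex_of_real y}"
    "(cmod \<rho>)\<^sup>2 = p * (1 - p)"
    and f: "\<And>g. fun_calc g ?a = herm2 (g y + (g x - g y) * p) (of_real (g x - g y) * \<rho>) (g x - (g x - g y) * p)"
    using selfadjoint_herm2 by (rule selfadjoint_2_spectral) blast
  have "?a = herm2 (y + (x - y) * p) (of_real (x - y) * \<rho>) (x - (x - y) * p)"
    using f[of "\<lambda>t. t"] by (simp add: fun_calc_id selfadjoint_herm2)
  then have e: "s = y + (x - y) * p" "complex_of_real q = of_real (x - y) * \<rho>" "s + d = x - (x - y) * p"
    unfolding herm2_eq_iff by auto
  \<comment> \<open>Subtracting \<open>s\<close> leaves a matrix with trace \<open>d\<close> and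
    determinant \<open>-q^2\<close>; \<open>X\<close> and \<open>Y\<close> are its
    eigenvalues.\<close>
  define X where "X = x - s"
  define Y where "Y = y - s"
  have XY: "X + Y = d" using e(1,3) by (simp add: X_def Y_def)
  have "(cmod (complex_of_real q))\<^sup>2 = (x - y)\<^sup>2 * (p * (1 - p))"
    unfolding e(2) by (simp only: norm_mult power_mult_distrib A(2) norm_of_real power2_abs)
  then have q: "q\<^sup>2 = (x - y)\<^sup>2 * (p * (1 - p))" by simp
  have Yp: "Y = - ((x - y) * p)" and Xp: "X = (x - y) * (1 - p)"
    using e(1) by (simp_all add: X_def Y_def algebra_simps)
  have prod: "X * Y = - q\<^sup>2"
    unfolding q Xp Yp by (simp add: power2_eq_square)
  show thesis
  proof (rule that[of X Y p])
    show "eigenvalues ?a = {complex_of_real (s + X), complex_of_real (s + Y)}"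
      unfolding A(1) by (simp add: X_def Y_def)
    show "X\<^sup>2 = d * X + q\<^sup>2" "Y\<^sup>2 = d * Y + q\<^sup>2"
      using prod unfolding XY[symmetric] by (simp_all add: power2_eq_square algebra_simps)
    show "p * X + (1 - p) * Y = 0"
      unfolding Xp Yp by (simp add: algebra_simps)
    show "Re (fun_calc g ?a $ 1 $ 1) = p * g (s + X) + (1 - p) * g (s + Y)" for g
      unfolding f by (simp add: X_def Y_def algebra_simps)
  qed
qed

text \<open>A root of \<open>Z^2 = d Z + q^2\<close> with \<open>|Z| > |d| + |q|\<close> would
  satisfy \<open>Z^2 \<le> (|d| + |q|) |Z| < Z^2\<close>.\<close>

lemma eigenvalues_real_herm2_near:
  assumes "\<bar>d\<bar> + \<bar>q\<bar> < r" and "\<And>t. \<bar>t - s\<bar> < r \<Longrightarrow> t \<in> I"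
  shows "eigenvalues (herm2 s (complex_of_real q) (s + d)) \<subseteq> complex_of_real ` I"
proof -
  obtain X Y and p :: real where e: "eigenvalues (herm2 s (complex_of_real q) (s + d)) = {complex_of_real (s + X), complex_of_real (s + Y)}"
    "X\<^sup>2 = d * X + q\<^sup>2" "Y\<^sup>2 = d * Y + q\<^sup>2"
    by (rule real_herm2_spectral_measure)
  have "\<bar>Z\<bar> \<le> \<bar>d\<bar> + \<bar>q\<bar>" if "Z\<^sup>2 = d * Z + q\<^sup>2" for Z
  proof (rule ccontr)
    assume *: "\<not> \<bar>Z\<bar> \<le> \<bar>d\<bar> + \<bar>q\<bar>"
    have "d * Z \<le> \<bar>d\<bar> * \<bar>Z\<bar>"
      by (metis abs_ge_self abs_mult)
    then have "\<bar>Z\<bar> * \<bar>Z\<bar> \<le> \<bar>d\<bar> * \<bar>Z\<bar> + \<bar>q\<bar> * \<bar>q\<bar>"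
      using that by (simp add: power2_eq_square)
    moreover have "\<bar>q\<bar> * \<bar>q\<bar> \<le> \<bar>q\<bar> * \<bar>Z\<bar>"
      using * by (intro mult_left_mono) auto
    ultimately have "\<bar>Z\<bar> * \<bar>Z\<bar> \<le> (\<bar>d\<bar> + \<bar>q\<bar>) * \<bar>Z\<bar>"
      by (simp add: distrib_right)
    moreover have "(\<bar>d\<bar> + \<bar>q\<bar>) * \<bar>Z\<bar> < \<bar>Z\<bar> * \<bar>Z\<bar>"
      using * by (intro mult_strict_right_mono) auto
    ultimately show False by simp
  qed
  then have "\<bar>X\<bar> < r" "\<bar>Y\<bar> < r" using e(2,3) assms(1) by fastforce+
  then show ?thesis unfolding e(1) using assms(2)[of "s + X"] assms(2)[of "s + Y"] by (auto simp del: of_real_add)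
qed

lemma fun_calc_quintic_11:
  fixes F0 F1 F2 F3 F4 F5 :: real
  shows "Re (fun_calc (\<lambda>t. F0 + F1 * (t - s) + F2 * (t - s)^2 + F3 * (t - s)^3 + F4 * (t - s)^4 + F5 * (t - s)^5)
      (herm2 s (complex_of_real q) (s + d)) $ 1 $ 1)
    = F0 + q^2 * (F2 + F3 * d + F4 * d^2 + F5 * d^3) + q^4 * (F4 + 2 * F5 * d)"
proof -
  obtain X Y p where X: "X\<^sup>2 = d * X + q\<^sup>2" and Y: "Y\<^sup>2 = d * Y + q\<^sup>2" and m1: "p * X + (1 - p) * Y = 0"
    and f: "\<And>g. Re (fun_calc g (herm2 s (complex_of_real q) (s + d)) $ 1 $ 1) = p * g (s + X) + (1 - p) * g (s + Y)"
    by (rule real_herm2_spectral_measure) blast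
  \<comment> \<open>\<open>m k\<close> is the (1,1) entry of the \<open>k\<close>-th power of the
    matrix minus \<open>s\<close>.\<close>
  define m where "m k = p * X ^ k + (1 - p) * Y ^ k" for k
  have rec: "m (Suc (Suc k)) = d * m (Suc k) + q\<^sup>2 * m k" for k
  proof -
    have "m (Suc (Suc k)) = p * (X ^ k * X\<^sup>2) + (1 - p) * (Y ^ k * Y\<^sup>2)"
      by (simp add: m_def power2_eq_square ac_simps)
    then show ?thesis unfolding X Y by (simp add: m_def algebra_simps)
  qed
  have m01: "m 0 = 1" "m (Suc 0) = 0" using m1 by (simp_all add: m_def)
  have "m 2 = q\<^sup>2" "m 3 = d * q\<^sup>2" "m 4 = d\<^sup>2 * q\<^sup>2 + q ^ 4" "m 5 = d ^ 3 * q\<^sup>2 + 2 * d * q ^ 4"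
    by (simp_all add: eval_nat_numeral rec m01 algebra_simps)
  moreover have "p * (F0 + F1 * X + F2 * X^2 + F3 * X^3 + F4 * X^4 + F5 * X^5)
     + (1 - p) * (F0 + F1 * Y + F2 * Y^2 + F3 * Y^3 + F4 * Y^4 + F5 * Y^5)
     = F0 + F1 * m (Suc 0) + F2 * m 2 + F3 * m 3 + F4 * m 4 + F5 * m 5"
    unfolding m_def by (simp add: algebra_simps)
  ultimately show ?thesis
    unfolding f using m01 by (simp add: algebra_simps)
qed

lemma positive_semidef_2_nth_1_1:
  fixes m :: "complex ^ 2 ^ 2"
  assumes "positive_semidef m"
  shows "0 \<le> Re (m $ 1 $ 1)"
proof -
  obtain p c r where m: "m = herm2 p c r"
    using assms selfadjoint_2_cases unfolding positive_semidef_def by blast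
  have "0 \<le> p + r" "(cmod c)\<^sup>2 \<le> p * r"
    using assms unfolding m positive_semidef_herm2_iff by auto
  moreover from this have "0 \<le> p * r" by (meson order_trans zero_le_power2)
  ultimately show ?thesis unfolding m by (auto simp: zero_le_mult_iff)
qed

text \<open>In the midpoint defect of the (1,1) entry the terms below \<open>e^4\<close> cancel. At
  order \<open>e^4\<close>, \<open>q^2\<close> contributes the \<open>F2\<close> term,
  \<open>q^2 d\<close> the \<open>F3\<close> term and \<open>q^2 d^2\<close> the \<open>F4\<close>
  term.\<close>

lemma two_convex_quintic_form:
  fixes F0 F1 F2 F3 F4 F5 \<gamma> \<delta> :: real
  assumes conv: "two_convex_on I
      (\<lambda>t. F0 + F1 * (t - s) + F2 * (t - s)^2 + F3 * (t - s)^3 + F4 * (t - s)^4 + F5 * (t - s)^5)"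
    and r: "0 < r" "\<And>t. \<bar>t - s\<bar> < r \<Longrightarrow> t \<in> I"
  shows "0 \<le> \<gamma>\<^sup>2 * F2 + 4 * \<gamma> * \<delta> * F3 + 4 * \<delta>\<^sup>2 * F4"
proof (rule tendsto_lowerbound)
  let ?f = "\<lambda>t. F0 + F1 * (t - s) + F2 * (t - s)^2 + F3 * (t - s)^3 + F4 * (t - s)^4 + F5 * (t - s)^5"
  \<comment> \<open>The part of the convexity defect of order at least \<open>e^6\<close>, divided
    by \<open>e^6\<close>.\<close>
  define R where "R e = 4 * \<gamma>\<^sup>2 * F4 + 16 * \<delta> * \<gamma> * F5 + F4 * (6 * \<delta>\<^sup>2 * \<gamma>\<^sup>2 + \<gamma>^4 * e\<^sup>2)
      + 16 * F5 * (\<delta>^3 * \<gamma> + \<delta> * \<gamma>^3 * e\<^sup>2)" for e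
  show "((\<lambda>e. \<gamma>\<^sup>2 * F2 + 4 * \<gamma> * \<delta> * F3 + 4 * \<delta>\<^sup>2 * F4 + e\<^sup>2 * R e)
     \<longlongrightarrow> \<gamma>\<^sup>2 * F2 + 4 * \<gamma> * \<delta> * F3 + 4 * \<delta>\<^sup>2 * F4) (at_right 0)"
    unfolding R_def by (auto intro!: tendsto_eq_intros)
  \<comment> \<open>For \<open>e < e0\<close> both test matrices satisfy
    \<open>|d| + |q| < r\<close>, which keeps their eigenvalues in \<open>I\<close>.\<close>
  define e0 where "e0 = min 1 (r / (3 + \<bar>\<delta>\<bar> + \<bar>\<gamma>\<bar>))"
  have e0: "0 < e0" using r by (simp add: e0_def add_pos_nonneg)
  have "0 \<le> \<gamma>\<^sup>2 * F2 + 4 * \<gamma> * \<delta> * F3 + 4 * \<delta>\<^sup>2 * F4 + e\<^sup>2 * R e" if e: "0 < e" "e < e0" for e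
  proof -
    have e1: "e < 1" and er: "e * (3 + \<bar>\<delta>\<bar> + \<bar>\<gamma>\<bar>) < r"
      using e by (auto simp: e0_def pos_less_divide_eq add_pos_nonneg)
    let ?a = "herm2 s (complex_of_real (e * (\<delta> + \<gamma> * e))) (s + 2 * e)"
    let ?b = "herm2 s (complex_of_real (e * (\<delta> - \<gamma> * e))) (s + - 2 * e)"
    let ?c = "herm2 s (complex_of_real (e * \<delta>)) (s + 0)"
    have near: "\<bar>2 * e\<bar> + \<bar>e * (\<delta> + c * e)\<bar> < r" if "\<bar>c\<bar> = \<bar>\<gamma>\<bar>" for c
    proof -
      have "\<bar>c * e\<bar> \<le> \<bar>\<gamma>\<bar>"
        using e1 e that by (simp add: abs_mult mult_left_le)
      then have "\<bar>\<delta> + c * e\<bar> \<le> \<bar>\<delta>\<bar> + \<bar>\<gamma>\<bar>" by linarith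
      then have "e * \<bar>\<delta> + c * e\<bar> \<le> e * (\<bar>\<delta>\<bar> + \<bar>\<gamma>\<bar>)" using e by simp
      moreover have "e * (3 + \<bar>\<delta>\<bar> + \<bar>\<gamma>\<bar>) = 3 * e + e * (\<bar>\<delta>\<bar> + \<bar>\<gamma>\<bar>)"
        by (simp add: algebra_simps)
      moreover have "\<bar>e * (\<delta> + c * e)\<bar> = e * \<bar>\<delta> + c * e\<bar>" "\<bar>2 * e\<bar> = 2 * e"
        using e by (simp_all add: abs_mult)
      ultimately show ?thesis using er e by linarith
    qed
    have "eigenvalues ?a \<subseteq> complex_of_real ` I"
      using near[of \<gamma>] r(2) by (intro eigenvalues_real_herm2_near[where r = r]) auto
    moreover have "eigenvalues ?b \<subseteq> complex_of_real ` I"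
      using near[of "- \<gamma>"] r(2) by (intro eigenvalues_real_herm2_near[where r = r]) auto
    ultimately have "fun_calc ?f ((1/2) *\<^sub>R ?a + (1 - 1/2) *\<^sub>R ?b)
        \<le>\<^sub>L (1/2) *\<^sub>R fun_calc ?f ?a + (1 - 1/2) *\<^sub>R fun_calc ?f ?b"
      using conv[unfolded two_convex_on_def, rule_format, of "1/2" ?a ?b] by (simp add: selfadjoint_herm2)
    moreover have "(1/2) *\<^sub>R ?a + (1 - 1/2) *\<^sub>R ?b = ?c"
      by (simp add: vec_eq_iff forall_2 complex_eq_iff field_simps)
    ultimately have "0 \<le> Re (((1/2) *\<^sub>R fun_calc ?f ?a + (1 - 1/2) *\<^sub>R fun_calc ?f ?b - fun_calc ?f ?c) $ 1 $ 1)"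
      unfolding loewner_le_def by (intro positive_semidef_2_nth_1_1) simp
    then have "0 \<le> 1/2 * Re (fun_calc ?f ?a $ 1 $ 1) + 1/2 * Re (fun_calc ?f ?b $ 1 $ 1) - Re (fun_calc ?f ?c $ 1 $ 1)"
      by simp
    also have "\<dots> = e^4 * (\<gamma>\<^sup>2 * F2 + 4 * \<gamma> * \<delta> * F3 + 4 * \<delta>\<^sup>2 * F4 + e\<^sup>2 * R e)"
      unfolding fun_calc_quintic_11 R_def by (simp add: field_simps eval_nat_numeral)
    finally show ?thesis using e by (simp add: zero_le_mult_iff)
  qed
  then show "\<forall>\<^sub>F e in at_right 0. 0 \<le> \<gamma>\<^sup>2 * F2 + 4 * \<gamma> * \<delta> * F3 + 4 * \<delta>\<^sup>2 * F4 + e\<^sup>2 * R e"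
    using e0 by (auto simp: eventually_at_right)
qed simp

section \<open>Algebra of binary quadratic forms\<close>

lemma nonneg_binary_quadratic_form:
  fixes A B C :: real
  assumes "\<And>\<gamma> \<delta>. 0 \<le> \<gamma>\<^sup>2 * A + 4 * \<gamma> * \<delta> * B + 4 * \<delta>\<^sup>2 * C"
  shows "0 \<le> A" "0 \<le> C" "B\<^sup>2 \<le> A * C"
proof -
  \<comment> \<open>In the variables \<open>\<gamma>\<close> and \<open>2 \<delta>\<close> the form
    has the matrix with rows \<open>(A, B)\<close> and \<open>(B, C)\<close>.\<close>
  show A: "0 \<le> A" and C: "0 \<le> C" using assms[of 1 0] assms[of 0 1] by auto
  show "B\<^sup>2 \<le> A * C"
  proof (cases "A = 0")
    case True
    have "0 \<le> - 4 * B\<^sup>2"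
      using assms[of "- (C + 1)" B] True by (simp add: power2_eq_square algebra_simps)
    then show ?thesis using A C by simp
  next
    case False
    have "0 \<le> 4 * A * (A * C - B\<^sup>2)"
      using assms[of "- 2 * B" A] by (simp add: power2_eq_square algebra_simps)
    then show ?thesis using False A by (simp add: zero_le_mult_iff)
  qed
qed

text \<open>
  The coefficients of the form in the hypothesis are \<open>f''/2\<close>, \<open>f'''/6\<close>, \<open>f''''/24\<close> at \<open>s\<close>; those in the
  conclusion are \<open>p'\<close>, \<open>p''/2\<close>, \<open>p'''/6\<close> at \<open>t\<close>.
\<close>

lemma quintic_convexity_imp_quartic_monotonicity:
  fixes a2 a3 a4 a5 t :: real
  assumes t: "0 < t"
    and conv: "\<And>s \<gamma> \<delta>. 0 < s \<Longrightarrow> s \<le> t \<Longrightarrow> 0 \<le> \<gamma>\<^sup>2 * (a2 + 3 * a3 * s + 6 * a4 * s^2 + 10 * a5 * s^3)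
       + 4 * \<gamma> * \<delta> * (a3 + 4 * a4 * s + 10 * a5 * s^2) + 4 * \<delta>\<^sup>2 * (a4 + 5 * a5 * s)"
  shows "0 \<le> a2 + 2 * a3 * t + 3 * a4 * t^2 + 4 * a5 * t^3"
    and "0 \<le> a4 + 4 * a5 * t"
    and "(a3 + 3 * a4 * t + 6 * a5 * t^2)\<^sup>2 \<le> (a2 + 2 * a3 * t + 3 * a4 * t^2 + 4 * a5 * t^3) * (a4 + 4 * a5 * t)"
proof -
  \<comment> \<open>The form at 0 is obtained as a limit, since the hypothesis covers only
    \<open>s > 0\<close>.\<close>
  have conv0: "0 \<le> \<gamma>\<^sup>2 * a2 + 4 * \<gamma> * \<delta> * a3 + 4 * \<delta>\<^sup>2 * a4" for \<gamma> \<delta>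
  proof (rule tendsto_lowerbound)
    show "((\<lambda>s. \<gamma>\<^sup>2 * (a2 + 3 * a3 * s + 6 * a4 * s^2 + 10 * a5 * s^3)
       + 4 * \<gamma> * \<delta> * (a3 + 4 * a4 * s + 10 * a5 * s^2) + 4 * \<delta>\<^sup>2 * (a4 + 5 * a5 * s))
       \<longlongrightarrow> \<gamma>\<^sup>2 * a2 + 4 * \<gamma> * \<delta> * a3 + 4 * \<delta>\<^sup>2 * a4) (at_right 0)"
      by (auto intro!: tendsto_eq_intros)
    show "\<forall>\<^sub>F s in at_right 0. 0 \<le> \<gamma>\<^sup>2 * (a2 + 3 * a3 * s + 6 * a4 * s^2 + 10 * a5 * s^3)
       + 4 * \<gamma> * \<delta> * (a3 + 4 * a4 * s + 10 * a5 * s^2) + 4 * \<delta>\<^sup>2 * (a4 + 5 * a5 * s)"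
      unfolding eventually_at_right[OF t] using t conv by (auto intro!: exI[of _ t])
  qed simp
  note D0 = nonneg_binary_quadratic_form[OF conv0]
  note D = nonneg_binary_quadratic_form[OF conv[OF t order_refl]]
  let ?A = "a2 + 2 * a3 * t + 3 * a4 * t^2 + 4 * a5 * t^3"
  let ?B = "a3 + 3 * a4 * t + 6 * a5 * t^2"
  let ?C = "a4 + 4 * a5 * t"
  have combine: "0 \<le> X" if "5 * X = 4 * Y + Z + W" "0 \<le> W" "0 \<le> Y" "0 \<le> Z" for X Y Z W :: real
    using that by linarith
  have "5 * (?A * ?C - ?B\<^sup>2)
     = 4 * ((a2 + 3 * a3 * t + 6 * a4 * t^2 + 10 * a5 * t^3) * (a4 + 5 * a5 * t)
            - (a3 + 4 * a4 * t + 10 * a5 * t^2)\<^sup>2)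
       + (a2 * a4 - a3\<^sup>2) + 10 * t\<^sup>2 * ((a4 + 3 * a5 * t)\<^sup>2 + (a5 * t)\<^sup>2)"
    by algebra
  then have "0 \<le> ?A * ?C - ?B\<^sup>2"
  proof (rule combine)
    show "0 \<le> 10 * t\<^sup>2 * ((a4 + 3 * a5 * t)\<^sup>2 + (a5 * t)\<^sup>2)"
      by (intro mult_nonneg_nonneg add_nonneg_nonneg) auto
  qed (use D(3) D0(3) in simp_all)
  then show det: "?B\<^sup>2 \<le> ?A * ?C" by simp
  \<comment> \<open>\<open>?C\<close> is the average of \<open>a4 + 5 a5 t\<close> and
    \<open>a4\<close> with weights 4/5 and 1/5.\<close>
  show C: "0 \<le> ?C" using D0(2) D(2) by linarith
  show "0 \<le> ?A"
  proof (cases "?C = 0")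
    case True
    \<comment> \<open>Both averaged terms are nonnegative, so both vanish; then
      \<open>a3^2 \<le> a2 a4 = 0\<close>, and \<open>?A\<close> reduces to
      \<open>a2\<close>.\<close>
    then have "a4 = 0" "a5 * t = 0" using D0(2) D(2) by linarith+
    then have "a4 = 0" "a5 = 0" using t by auto
    then have "a3 = 0" using D0(3) by simp
    then show ?thesis using D0(1) \<open>a4 = 0\<close> \<open>a5 = 0\<close> by simp
  next
    case False
    have "0 \<le> ?A * ?C" using det by (meson order_trans zero_le_power2)
    then show ?thesis using False C by (simp add: zero_le_mult_iff)
  qed
qed

text \<open>A sum of positive semidefinite matrices is positive semidefinite; the mixed term is
  handled by the arithmetic-geometric mean inequality.\<close>

lemma psd_determinant_add:
  fixes A B C A' B' C' :: real
  assumes "0 \<le> A" "0 \<le> C" "B\<^sup>2 \<le> A * C" "0 \<le> A'" "0 \<le> C'" "B'\<^sup>2 \<le> A' * C'"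
  shows "(B + B')\<^sup>2 \<le> (A + A') * (C + C')"
proof -
  have "(2 * (B * B'))\<^sup>2 = 4 * (B\<^sup>2 * B'\<^sup>2)" by (simp add: power_mult_distrib)
  also have "\<dots> \<le> 4 * ((A * C) * (A' * C'))"
    using assms by (intro mult_left_mono mult_mono) auto
  also have "\<dots> = (A * C' + A' * C)\<^sup>2 - (A * C' - A' * C)\<^sup>2"
    by (simp add: power2_eq_square algebra_simps)
  also have "\<dots> \<le> (A * C' + A' * C)\<^sup>2" by simp
  finally have "2 * (B * B') \<le> A * C' + A' * C"
    by (rule power2_le_imp_le) (use assms in simp)
  then show ?thesis
    using assms(3,6) by (simp add: power2_eq_square algebra_simps)
qed

section \<open>The quotient \<open>f(t) / t\<close>\<close>

theorem proposition3p6: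
  fixes \<alpha> :: ereal and f :: "real poly"
  assumes "0 < \<alpha>"
    and "degree f \<le> 5"
    and "two_convex_on {t. 0 \<le> t \<and> ereal t < \<alpha>} (poly f)"
    and "poly f 0 \<le> 0"
  shows "two_monotone_on {t. 0 < t \<and> ereal t < \<alpha>} (\<lambda>t. poly f t / t)"
proof -
  define a where "a = coeff f"
  have f: "poly f t = a 0 + a 1 * t + a 2 * t^2 + a 3 * t^3 + a 4 * t^4 + a 5 * t^5" for t
  proof -
    have "poly f t = (\<Sum>i\<le>5. a i * t ^ i)"
      unfolding poly_altdef a_def using assms(2)
      by (intro sum.mono_neutral_left) (auto simp: coeff_eq_0)
    then show ?thesis by (simp add: eval_nat_numeral)
  qed
  have a0: "a 0 \<le> 0" using assms(4) f[of 0] by simp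
  have conv: "0 \<le> \<gamma>\<^sup>2 * (a 2 + 3 * a 3 * s + 6 * a 4 * s^2 + 10 * a 5 * s^3)
       + 4 * \<gamma> * \<delta> * (a 3 + 4 * a 4 * s + 10 * a 5 * s^2) + 4 * \<delta>\<^sup>2 * (a 4 + 5 * a 5 * s)"
    if s: "0 < s" "ereal s < \<alpha>" for s \<gamma> \<delta>
  proof -
    \<comment> \<open>The point \<open>u\<close> provides a finite radius around \<open>s\<close>
      even when \<open>\<alpha>\<close> is infinite.\<close>
    obtain u where u: "s < u" "ereal u < \<alpha>"
      using ereal_dense2[OF s(2)] by auto
    show ?thesis
    proof (rule two_convex_quintic_form)
      \<comment> \<open>Taylor expansion at \<open>s\<close>.\<close>
      have "poly f = (\<lambda>t. poly f s + (a 1 + 2 * a 2 * s + 3 * a 3 * s^2 + 4 * a 4 * s^3 + 5 * a 5 * s^4) * (t - s)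
         + (a 2 + 3 * a 3 * s + 6 * a 4 * s^2 + 10 * a 5 * s^3) * (t - s)^2
         + (a 3 + 4 * a 4 * s + 10 * a 5 * s^2) * (t - s)^3 + (a 4 + 5 * a 5 * s) * (t - s)^4
         + a 5 * (t - s)^5)"
        unfolding f by (rule ext) algebra
      with assms(3) show "two_convex_on {t. 0 \<le> t \<and> ereal t < \<alpha>}
        (\<lambda>t. poly f s + (a 1 + 2 * a 2 * s + 3 * a 3 * s^2 + 4 * a 4 * s^3 + 5 * a 5 * s^4) * (t - s)
         + (a 2 + 3 * a 3 * s + 6 * a 4 * s^2 + 10 * a 5 * s^3) * (t - s)^2
         + (a 3 + 4 * a 4 * s + 10 * a 5 * s^2) * (t - s)^3 + (a 4 + 5 * a 5 * s) * (t - s)^4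
         + a 5 * (t - s)^5)"
        by simp
      show "0 < min s (u - s)" using s u by simp
      show "t \<in> {t. 0 \<le> t \<and> ereal t < \<alpha>}" if "\<bar>t - s\<bar> < min s (u - s)" for t
      proof -
        have "0 \<le> t" "t < u" using that by linarith+
        then show ?thesis using u(2) by (auto intro: less_trans[of "ereal t" "ereal u"])
      qed
    qed
  qed
  let ?I = "{t. 0 < t \<and> ereal t < \<alpha>}"
  let ?A = "\<lambda>t. a 2 + 2 * a 3 * t + 3 * a 4 * t^2 + 4 * a 5 * t^3"
  let ?B = "\<lambda>t. a 3 + 3 * a 4 * t + 6 * a 5 * t^2"
  let ?C = "\<lambda>t. a 4 + 4 * a 5 * t"
  have quartic: "0 \<le> ?A t" "0 \<le> ?C t" "(?B t)\<^sup>2 \<le> ?A t * ?C t" if "t \<in> ?I" for t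
  proof -
    have t: "0 < t" "ereal t < \<alpha>" using that by auto
    have c: "0 \<le> \<gamma>\<^sup>2 * (a 2 + 3 * a 3 * s + 6 * a 4 * s^2 + 10 * a 5 * s^3)
       + 4 * \<gamma> * \<delta> * (a 3 + 4 * a 4 * s + 10 * a 5 * s^2) + 4 * \<delta>\<^sup>2 * (a 4 + 5 * a 5 * s)"
      if "0 < s" "s \<le> t" for s \<gamma> \<delta>
      using that t(2) by (intro conv) (auto intro: le_less_trans[of "ereal s" "ereal t"])
    show "0 \<le> ?A t" "0 \<le> ?C t" "(?B t)\<^sup>2 \<le> ?A t * ?C t"
      using quintic_convexity_imp_quartic_monotonicity[OF t(1) c] by blast+
  qed
  \<comment> \<open>For \<open>-b / t\<close> the derivatives of orders 1, 2, 3 divided by 1, 2, 6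
    are \<open>b / t^2\<close>, \<open>-b / t^3\<close>, \<open>b / t^4\<close>. They form a matrix
    of determinant 0, positive semidefinite as \<open>b \<ge> 0\<close>.\<close>
  let ?b = "- a 0"
  show ?thesis
  proof (rule two_monotone_onI_deriv)
    show "convex ?I"
      unfolding is_interval_convex_1[symmetric] is_interval_1
      by (auto intro: le_less_trans[of "ereal _" "ereal _"])
    fix t assume tI: "t \<in> ?I"
    then have t: "0 < t" by simp
    show "((\<lambda>t. poly f t / t) has_real_derivative ?A t + ?b / t^2) (at t)"
      unfolding f using t
      by (auto intro!: derivative_eq_intros simp: field_simps power2_eq_square eval_nat_numeral)
    show "((\<lambda>t. ?A t + ?b / t^2) has_real_derivative 2 * (?B t + - ?b / t^3)) (at t)"
      using t by (auto intro!: derivative_eq_intros simp: field_simps eval_nat_numeral)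
    show "((\<lambda>t. 2 * (?B t + - ?b / t^3)) has_real_derivative 6 * (?C t + ?b / t^4)) (at t)"
      using t by (auto intro!: derivative_eq_intros simp: field_simps eval_nat_numeral)
    have b: "0 \<le> ?b / t^2" "0 \<le> ?b / t^4" "(- ?b / t^3)\<^sup>2 \<le> ?b / t^2 * (?b / t^4)"
      using a0 t by (auto simp: divide_simps power2_eq_square eval_nat_numeral)
    show "0 \<le> ?A t + ?b / t^2" using quartic(1)[OF tI] b(1) by (rule add_nonneg_nonneg)
    show "0 \<le> 6 * (?C t + ?b / t^4)" using quartic(2)[OF tI] b(2) by simp
    have "(?B t + - ?b / t^3)\<^sup>2 \<le> (?A t + ?b / t^2) * (?C t + ?b / t^4)"
      by (rule psd_determinant_add[OF quartic[OF tI] b])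
    \<comment> \<open>With \<open>g'' = 2 X\<close>, \<open>g' = Y\<close> and
      \<open>g''' = 6 Z\<close> both sides carry the factor 12.\<close>
    moreover have "3 * (2 * X)\<^sup>2 \<le> 2 * Y * (6 * Z)" if "X\<^sup>2 \<le> Y * Z" for X Y Z :: real
      using that by (simp add: power_mult_distrib)
    ultimately show "3 * (2 * (?B t + - ?b / t^3))\<^sup>2 \<le> 2 * (?A t + ?b / t^2) * (6 * (?C t + ?b / t^4))"
      by blast
  qed
qed

end
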